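(* Let $l < x_0 \le r$ and let $g$ be a continuous, positive and strictly increasing function on $(l,x_0)$, twice differentiable there, with $g(x)>0$ and $g'(x)>0$ for all $x\in(l,x_0)$. Define $$P(x)=f(x)\frac{g(x)}{g'(x)},\qquad x\in(l,x_0),$$ and suppose that $\lim_{x\to l}P(x)=0$. (i) The function $\dfrac{f(x)}{g'(x)}$ is increasing on $(l,x_0)$ if and only if $P'(x)-f(x)\ge 0$ for all $x\in(l,x_0)$; and if this holds, then $$F(x)\le P(x)\qquad\text{for all }x\in(l,x_0).$$ (ii) The function $\dfrac{f(x)}{g'(x)}$ is decreasing on $(l,x_0)$ if and only if $P'(x)-f(x)\le 0$ for all $x\in(l,x_0)$; and if this holds, then $$F(x)\ge P(x)\qquad\text{for all }x\in(l,x_0).$$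
   Context: $X$ is a continuous real random variable with cumulative distribution function $F(x)=\Pr\{X\le x\}$ and probability density function $f(x)=F'(x)$. The support of $f$ is an interval with endpoints $l$ and $r$, $-\infty\le l<r\le\infty$, each endpoint being included or not. The density $f$ is continuous on the support and its derivative $f'$ exists there. "Decreasing" and "increasing" without the word "strictly" are meant in the weak sense (derivative $\le 0$, respectively $\ge 0$). The limit as $x\to l$ is taken from the right. *)

theory Defs
  imports "HOL-Probability.Probability"
begin

text \<open>
  Authors differ on whether the support of a density is the set where it does not vanish or the
  closure of that set, and on whether an endpoint at which it vanishes belongs to it. The predicate
  below admits all these conventions: a set lying between the two extremes.
\<close>

definition is_support :: "(real \<Rightarrow> real) \<Rightarrow> real set \<Rightarrow> bool" where
  "is_support f S \<longleftrightarrow> support_on UNIV f \<subseteq> S \<and> S \<subseteq> closure (support_on UNIV f)"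

text \<open>
  \<open>einterval l r\<close> is the open interval; what is left open below is whether the finite ones
  among \<open>l\<close> and \<open>r\<close> belong to \<open>S\<close>.
\<close>

definition interval_with_endpoints :: "ereal \<Rightarrow> ereal \<Rightarrow> real set \<Rightarrow> bool" where
  "interval_with_endpoints l r S \<longleftrightarrow>
     l < r \<and> einterval l r \<subseteq> S \<and> S \<subseteq> {x. l \<le> ereal x \<and> ereal x \<le> r}"

definition bound_fun :: "(real \<Rightarrow> real) \<Rightarrow> (real \<Rightarrow> real) \<Rightarrow> real \<Rightarrow> real" where
  "bound_fun f g x = f x * (g x / deriv g x)"

end

theory Submission
  imports Defs
begin

text \<open>
  Write \<open>q = f / g'\<close>, so that \<open>P = q g\<close>. The product rule gives \<open>P' = q' g + q g' = q' g + f\<close>,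
  that is, \<open>P' - f = q' g\<close> (\<open>has_real_derivative_bound_fun\<close>). As \<open>g > 0\<close>, the sign of
  \<open>P' - f\<close> at each point is that of \<open>q'\<close>, and the sign of \<open>q'\<close> on the whole interval decides whether
  \<open>q\<close> is monotone; this gives both equivalences.

  For the bounds, \<open>f\<close> is the derivative of \<open>F\<close> at every point of \<open>(l, x0)\<close>, where it is
  continuous (\<open>has_real_derivative_cdf_density\<close>). So \<open>P' - f\<close> is the derivative of \<open>P - F\<close>, and
  if it has a constant sign, then \<open>P - F\<close> is monotone. At the left endpoint \<open>P\<close> tends to \<open>0\<close> by
  hypothesis and \<open>F\<close> does because the distribution has no mass to the left of \<open>l\<close>
  (\<open>cdf_density_tendsto_left_endpoint\<close>). A monotone function on an interval has the sign that
  its vanishing limit at the left endpoint forces (\<open>mono_on_einterval_nonneg\<close>), and this is the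
  comparison of \<open>F\<close> with \<open>P\<close>. The decreasing case is the increasing case for \<open>- q\<close> and \<open>F - P\<close>.
\<close>

section \<open>Monotonicity on intervals\<close>

lemma is_interval_einterval: "is_interval (einterval a b)"
  unfolding is_interval_1
proof (intro ballI allI impI)
  fix x y z assume xyz: "x \<in> einterval a b" "y \<in> einterval a b" "x \<le> z \<and> z \<le> y"
  then have "a < ereal x" "ereal x \<le> ereal z" "ereal z \<le> ereal y" "ereal y < b"
    by (auto simp: einterval_iff)
  then show "z \<in> einterval a b"
    using less_le_trans[of a "ereal x" "ereal z"] le_less_trans[of "ereal z" "ereal y" b]
    by (simp add: einterval_iff)
qed

lemma mono_on_iff_deriv_nonneg:
  fixes h h' :: "real \<Rightarrow> real"
  assumes "open I" "is_interval I"
    and deriv: "\<And>x. x \<in> I \<Longrightarrow> (h has_real_derivative h' x) (at x)"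
  shows "mono_on I h \<longleftrightarrow> (\<forall>x\<in>I. 0 \<le> h' x)"
proof
  assume "mono_on I h"
  then show "\<forall>x\<in>I. 0 \<le> h' x"
    using mono_on_imp_deriv_nonneg deriv \<open>open I\<close> by (metis interior_open)
next
  assume nonneg: "\<forall>x\<in>I. 0 \<le> h' x"
  show "mono_on I h"
  proof (rule mono_onI)
    fix x y assume xy: "x \<in> I" "y \<in> I" "x \<le> y"
    have "z \<in> I" if "x \<le> z" "z \<le> y" for z
      using \<open>is_interval I\<close> xy that unfolding is_interval_1 by blast
    then show "h x \<le> h y"
      using deriv nonneg by (intro DERIV_nonneg_imp_nondecreasing[OF xy(3)]) blast
  qed
qed

lemma antimono_on_iff_mono_on_uminus:
  fixes h :: "real \<Rightarrow> real"
  shows "antimono_on I h \<longleftrightarrow> mono_on I (\<lambda>x. - h x)"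
  by (simp add: monotone_on_def)

text \<open>
  Every value \<open>h x\<close> is an upper bound of \<open>h\<close> to the left of \<open>x\<close>, hence of the limit.
\<close>

lemma mono_on_einterval_nonneg:
  fixes h :: "real \<Rightarrow> real"
  assumes "mono_on (einterval l u) h"
    and lim: "((h \<circ> real_of_ereal) \<longlongrightarrow> 0) (at_right l)"
    and x: "x \<in> einterval l u"
  shows "0 \<le> h x"
proof (rule tendsto_upperbound[OF lim])
  have less: "l < ereal x" "ereal x < u"
    using x by (auto simp: einterval_iff)
  then show "at_right l \<noteq> bot"
    unfolding trivial_limit_def eventually_at_right[OF less(1)] using dense by blast
  show "\<forall>\<^sub>F y in at_right l. (h \<circ> real_of_ereal) y \<le> h x"
    unfolding eventually_at_right[OF less(1)]
  proof (intro exI[of _ "ereal x"] conjI allI impI)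
    fix y assume y: "l < y" "y < ereal x"
    then obtain t where t: "y = ereal t"
      by (cases y) auto
    have "t \<in> einterval l u"
      using y t less_trans[OF y(2) less(2)] by (simp add: einterval_iff)
    then show "(h \<circ> real_of_ereal) y \<le> h x"
      using y t x assms(1) by (auto intro: mono_onD)
  qed (fact less)
qed

section \<open>The distribution function of a density\<close>

lemma emeasure_density_Ioc:
  fixes f :: "real \<Rightarrow> real"
  assumes [measurable]: "f \<in> borel_measurable borel" and nonneg: "\<And>x. 0 \<le> f x"
    and cont: "continuous_on {a..b} f"
  shows "emeasure (density lborel f) {a<..b} = ennreal (integral {a..b} f)"
proof -
  have "emeasure (density lborel f) {a<..b} = (\<integral>\<^sup>+x. ennreal (f x) * indicator {a<..b} x \<partial>lborel)"
    by (simp add: emeasure_density)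
  also have "\<dots> = (\<integral>\<^sup>+x. ennreal (f x * indicator {a..b} x) \<partial>lborel)"
  proof (rule nn_integral_cong_AE)
    show "AE x in lborel. ennreal (f x) * indicator {a<..b} x = ennreal (f x * indicator {a..b} x)"
      using AE_lborel_singleton[of a] by eventually_elim (auto split: split_indicator)
  qed
  also have "\<dots> = ennreal (integral {a..b} f)"
  proof (rule nn_integral_has_integral_lborel)
    have "(f has_integral integral {a..b} f) {a..b}"
      using integrable_continuous_real[OF cont] by blast
    then show "((\<lambda>x. f x * indicator {a..b} x) has_integral integral {a..b} f) UNIV"
      by (subst (asm) has_integral_restrict_UNIV[symmetric])
        (simp add: indicator_def of_bool_def if_distrib cong: if_cong)
  qed (auto simp: nonneg)
  finally show ?thesis .
qed

text \<open>
  On a compact neighbourhood \<open>{a..b}\<close> of the point inside \<open>U\<close>, the distribution function is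
  \<open>F a\<close> plus the integral of the continuous function \<open>f\<close> from \<open>a\<close>, so the fundamental theorem of
  calculus applies.
\<close>

lemma has_real_derivative_cdf_density:
  fixes f :: "real \<Rightarrow> real"
  assumes "finite_borel_measure (density lborel f)"
    and meas: "f \<in> borel_measurable borel" and nonneg: "\<And>x. 0 \<le> f x"
    and "open U" "continuous_on U f" "x \<in> U"
  shows "(cdf (density lborel f) has_real_derivative f x) (at x)"
proof -
  interpret finite_borel_measure "density lborel f" by fact
  let ?F = "cdf (density lborel f)"
  obtain d where d: "d > 0" "cball x d \<subseteq> U"
    using \<open>open U\<close> \<open>x \<in> U\<close> open_contains_cball by blast
  define a b where "a = x - d" and "b = x + d"
  have ab: "x \<in> {a<..<b}" "{a..b} \<subseteq> U"
    using d by (auto simp: a_def b_def cball_eq_atLeastAtMost)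
  have cont: "continuous_on {a..b} f"
    using \<open>continuous_on U f\<close> ab(2) by (rule continuous_on_subset)
  have F_eq: "?F y = ?F a + integral {a..y} f" if "y \<in> {a<..<b}" for y
  proof -
    have "continuous_on {a..y} f"
      using that by (intro continuous_on_subset[OF cont]) auto
    then have "ennreal (?F y - ?F a) = ennreal (integral {a..y} f)"
      using emeasure_Ioc[of a y] emeasure_density_Ioc[OF meas nonneg] that by simp
    moreover have "0 \<le> ?F y - ?F a" "0 \<le> integral {a..y} f"
      using cdf_nondecreasing[of a y] that nonneg by (auto intro: integral_nonneg
          integrable_continuous_real \<open>continuous_on {a..y} f\<close>)
    ultimately show ?thesis by simp
  qed
  have "((\<lambda>y. integral {a..y} f) has_real_derivative f x) (at x within {a..b})"
    using ab by (intro integral_has_real_derivative cont) auto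
  then have "((\<lambda>y. ?F a + integral {a..y} f) has_real_derivative f x) (at x within {a..b})"
    by (auto intro!: derivative_eq_intros)
  then have "((\<lambda>y. ?F a + integral {a..y} f) has_real_derivative f x) (at x)"
    using ab(1) by (simp add: at_within_Icc_at)
  then show ?thesis
    by (rule has_field_derivative_transform_within_open[of _ _ _ "{a<..<b}"])
      (use ab(1) F_eq in auto)
qed

text \<open>
  For \<open>l = -\<infinity>\<close> this is the limit at \<open>-\<infinity>\<close> of any distribution function. For a finite \<open>l\<close>,
  the density vanishes on \<open>{..l}\<close> outside the null set \<open>{l}\<close>; so \<open>F(l) = 0\<close>, and \<open>F\<close> is
  continuous from the right.
\<close>

lemma cdf_density_tendsto_left_endpoint:
  fixes f :: "real \<Rightarrow> real"
  assumes "finite_borel_measure (density lborel f)"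
    and [measurable]: "f \<in> borel_measurable borel"
    and zero: "\<And>x. ereal x < l \<Longrightarrow> f x = 0" and "l < \<infinity>"
  shows "((cdf (density lborel f) \<circ> real_of_ereal) \<longlongrightarrow> 0) (at_right l)"
proof (cases l)
  case (real a)
  interpret finite_borel_measure "density lborel f" by fact
  have "emeasure (density lborel f) {..a} = (\<integral>\<^sup>+x. ennreal (f x) * indicator {..a} x \<partial>lborel)"
    by (simp add: emeasure_density)
  also have "\<dots> = (\<integral>\<^sup>+x. 0 \<partial>(lborel :: real measure))"
  proof (rule nn_integral_cong_AE)
    show "AE x in lborel. ennreal (f x) * indicator {..a} x = 0"
      using AE_lborel_singleton[of a]
      by eventually_elim (auto simp: zero real split: split_indicator)
  qed
  finally have "cdf (density lborel f) a = 0"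
    by (simp add: cdf_def measure_def)
  then show ?thesis
    using cdf_is_right_cont[of a] by (simp add: real ereal_tendsto_simps continuous_within)
next
  case MInf
  interpret finite_borel_measure "density lborel f" by fact
  show ?thesis
    using cdf_lim_at_bot by (simp add: MInf ereal_tendsto_simps)
qed (use \<open>l < \<infinity>\<close> in simp)

section \<open>Comparison of the distribution function with the bound\<close>

lemma has_real_derivative_bound_fun:
  fixes f g :: "real \<Rightarrow> real"
  assumes q: "((\<lambda>x. f x / deriv g x) has_real_derivative D) (at x)"
    and g: "g differentiable (at x)" "deriv g x \<noteq> 0"
  shows "(bound_fun f g has_real_derivative D * g x + f x) (at x)"
proof -
  have "(g has_real_derivative deriv g x) (at x)"
    using g(1) by (simp add: DERIV_deriv_iff_real_differentiable)
  from DERIV_mult[OF q this]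
  have "((\<lambda>x. f x / deriv g x * g x) has_real_derivative D * g x + f x) (at x)"
    using g(2) by (simp add: ac_simps)
  moreover have "bound_fun f g = (\<lambda>x. f x / deriv g x * g x)"
    by (simp add: bound_fun_def fun_eq_iff)
  ultimately show ?thesis by simp
qed

theorem theorem2:
  fixes M :: "'a measure" and X :: "'a \<Rightarrow> real" and f g :: "real \<Rightarrow> real"
    and S :: "real set" and l r x0 :: ereal
  assumes "prob_space M"
    and "\<And>x. 0 \<le> f x"
    and "distributed M lborel X f"
    and "is_support f S"
    and "interval_with_endpoints l r S"
    and "continuous_on S f"
    and "f differentiable_on S"
    and "l < x0" and "x0 \<le> r"
    and "continuous_on (einterval l x0) g"
    and "\<And>x. x \<in> einterval l x0 \<Longrightarrow> 0 < g x"
    and "strict_mono_on (einterval l x0) g"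
    and "\<And>x. x \<in> einterval l x0 \<Longrightarrow> g differentiable (at x)"
    and "\<And>x. x \<in> einterval l x0 \<Longrightarrow> deriv g differentiable (at x)"
    and "\<And>x. x \<in> einterval l x0 \<Longrightarrow> 0 < deriv g x"
    and "((bound_fun f g \<circ> real_of_ereal) \<longlongrightarrow> 0) (at_right l)"
  shows
    "(mono_on (einterval l x0) (\<lambda>x. f x / deriv g x) \<longleftrightarrow>
        (\<forall>x\<in>einterval l x0. deriv (bound_fun f g) x - f x \<ge> 0)) \<and>
     (mono_on (einterval l x0) (\<lambda>x. f x / deriv g x) \<longrightarrow>
        (\<forall>x\<in>einterval l x0. cdf (distr M borel X) x \<le> bound_fun f g x)) \<and>
     (antimono_on (einterval l x0) (\<lambda>x. f x / deriv g x) \<longleftrightarrow>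
        (\<forall>x\<in>einterval l x0. deriv (bound_fun f g) x - f x \<le> 0)) \<and>
     (antimono_on (einterval l x0) (\<lambda>x. f x / deriv g x) \<longrightarrow>
        (\<forall>x\<in>einterval l x0. cdf (distr M borel X) x \<ge> bound_fun f g x))"
proof -
  interpret M: prob_space M by fact
  let ?I = "einterval l x0"
  define q where "q = (\<lambda>x. f x / deriv g x)"
  define P where "P = bound_fun f g"
  define F where "F = cdf (density lborel f)"

  have meas: "f \<in> borel_measurable borel"
    using distributed_real_measurable[of lborel f M X] assms(2,3) by simp
  have distr: "distr M borel X = density lborel f"
    using distributed_distr_eq_density[OF assms(3)] by (simp cong: distr_cong)
  have "X \<in> borel_measurable M"
    using distributed_measurable[OF assms(3)] by simp
  then have fin: "finite_borel_measure (density lborel f)"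
    unfolding distr[symmetric]
    by (intro real_distribution.finite_borel_measure_M M.real_distribution_distr)

  have "?I \<subseteq> einterval l r"
    using less_le_trans[OF _ assms(9)] by (auto simp: einterval_iff)
  then have I_S: "?I \<subseteq> S"
    using assms(5) unfolding interval_with_endpoints_def by blast
  have f_zero: "f x = 0" if "ereal x < l" for x
  proof (rule ccontr)
    assume "f x \<noteq> 0"
    then have "x \<in> S"
      using assms(4) by (auto simp: is_support_def support_on_def)
    then show False
      using assms(5) that by (auto simp: interval_with_endpoints_def)
  qed

  have q_deriv: "(q has_real_derivative deriv q x) (at x)" if "x \<in> ?I" for x
  proof -
    have "f differentiable (at x)"
      using differentiable_on_subset[OF assms(7) I_S] that
      by (simp add: differentiable_on_eq_differentiable_at)
    then have "q differentiable (at x)"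
      unfolding q_def using assms(14,15)[OF that] by (intro differentiable_divide) auto
    then show ?thesis
      by (simp add: DERIV_deriv_iff_real_differentiable)
  qed
  have P_deriv': "(P has_real_derivative deriv q x * g x + f x) (at x)" if "x \<in> ?I" for x
    unfolding P_def using q_deriv[OF that] assms(13,15)[OF that]
    by (intro has_real_derivative_bound_fun) (auto simp: q_def)
  have deriv_P: "deriv P x - f x = deriv q x * g x" if "x \<in> ?I" for x
    using DERIV_imp_deriv[OF P_deriv'[OF that]] by simp
  have P_deriv: "(P has_real_derivative deriv P x) (at x)" if "x \<in> ?I" for x
    using P_deriv'[OF that] by (simp add: DERIV_imp_deriv)
  have F_deriv: "(F has_real_derivative f x) (at x)" if "x \<in> ?I" for x
    unfolding F_def using that assms(2,6) I_S meas
    by (intro has_real_derivative_cdf_density[where U = ?I] fin)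
      (auto intro: continuous_on_subset)

  have F_lim: "((F \<circ> real_of_ereal) \<longlongrightarrow> 0) (at_right l)"
    unfolding F_def using assms(8) f_zero meas
    by (intro cdf_density_tendsto_left_endpoint fin) auto
  have P_lim: "((P \<circ> real_of_ereal) \<longlongrightarrow> 0) (at_right l)"
    unfolding P_def by (rule assms(16))

  note mono_iff = mono_on_iff_deriv_nonneg[OF open_einterval is_interval_einterval, of l x0]

  have sign: "0 \<le> deriv P x - f x \<longleftrightarrow> 0 \<le> deriv q x" "deriv P x - f x \<le> 0 \<longleftrightarrow> deriv q x \<le> 0"
    if "x \<in> ?I" for x
    unfolding deriv_P[OF that]
    using mult_le_cancel_right_pos[OF assms(11)[OF that], of 0 "deriv q x"]
      mult_le_cancel_right_pos[OF assms(11)[OF that], of "deriv q x" 0] by simp_all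
  have inc: "mono_on ?I q \<longleftrightarrow> (\<forall>x\<in>?I. 0 \<le> deriv P x - f x)"
    using mono_iff[OF q_deriv] by (simp add: sign del: diff_ge_0_iff_ge diff_le_0_iff_le)
  have dec: "antimono_on ?I q \<longleftrightarrow> (\<forall>x\<in>?I. deriv P x - f x \<le> 0)"
    unfolding antimono_on_iff_mono_on_uminus
    using mono_iff[OF DERIV_minus[OF q_deriv]] by (simp add: sign del: diff_ge_0_iff_ge diff_le_0_iff_le)

  have inc_bound: "F x \<le> P x" if "mono_on ?I q" "x \<in> ?I" for x
  proof -
    have "mono_on ?I (\<lambda>x. P x - F x)"
      using mono_iff[OF DERIV_diff[OF P_deriv F_deriv]] inc that(1) by simp
    moreover have "(((\<lambda>x. P x - F x) \<circ> real_of_ereal) \<longlongrightarrow> 0) (at_right l)"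
      using tendsto_diff[OF P_lim F_lim] by (simp add: comp_def)
    ultimately show ?thesis
      using mono_on_einterval_nonneg that(2) by fastforce
  qed
  have dec_bound: "P x \<le> F x" if "antimono_on ?I q" "x \<in> ?I" for x
  proof -
    have "mono_on ?I (\<lambda>x. F x - P x)"
      using mono_iff[OF DERIV_diff[OF F_deriv P_deriv]] dec that(1) by simp
    moreover have "(((\<lambda>x. F x - P x) \<circ> real_of_ereal) \<longlongrightarrow> 0) (at_right l)"
      using tendsto_diff[OF F_lim P_lim] by (simp add: comp_def)
    ultimately show ?thesis
      using mono_on_einterval_nonneg that(2) by fastforce
  qed

  show ?thesis
    using inc inc_bound dec dec_bound unfolding distr F_def P_def q_def by blast
qed

end
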